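(* Let $\alpha,\beta$ be positive real constants. (1) If $\phi=(\phi_n)_{n\ge1}$ is a sequence of positive integers with $\phi_n\to\infty$ and $\frac{\phi_n}{n}\to0$ as $n\to\infty$, then $\phi\notin\mathcal{RR}$. (2) The sequence $(\lfloor n^{\alpha}\rfloor)_{n\ge1}$ is in $\mathcal{RR}$ if and only if $\alpha>1$. (3) The sequence $(\lfloor\beta^n\rfloor)_{n\ge1}$ is in $\mathcal{RR}$ if and only if $\beta\ge1$.
   Context: For a map $T:X\to X$ on a set $X$ and $n\ge 1$, let $f_n(T)=\#\{x\in X\mid T^n x=x\}$ be the number of points with period $n$; all maps considered are assumed to have $f_n(T)$ finite for every $n\ge1$. A sequence $\phi=(\phi_n)_{n\ge1}$ of non-negative integers is realizable in rate, written $\phi\in\mathcal{RR}$, if there is a set $X$ and a map $T:X\to X$ with $f_n(T)/\phi_n\to1$ as $n\to\infty$. A sequence $\phi$ with $\phi_n=0$ for infinitely many $n$ is regarded as not satisfying this limit condition, hence as not in $\mathcal{RR}$. $\lfloor x\rfloor$ denotes the greatest integer less than or equal to $x$. *)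

theory Defs
  imports Complex_Main "HOL-Library.FuncSet" "HOL-Library.Countable_Set"
    "HOL-Library.Infinite_Typeclass"
begin

definition num_periodic :: "'a set \<Rightarrow> ('a \<Rightarrow> 'a) \<Rightarrow> nat \<Rightarrow> nat" where
  "num_periodic X T n = card {x \<in> X. (T ^^ n) x = x}"

text \<open>
  Sequences are indexed by the integers \<open>n \<ge> 1\<close>; the value at \<open>0\<close> is ignored.
  HOL cannot quantify existentially over types, so the type in which the set \<open>X\<close> lives is a
  parameter. The lemma \<open>RR_transfer\<close> below shows that it does not matter which type is used, as
  long as it is infinite.
  Since \<open>x / 0 = 0\<close>, a sequence vanishing at infinitely many \<open>n\<close> cannot satisfy the limit
  condition.
\<close>

definition RR :: "'a itself \<Rightarrow> (nat \<Rightarrow> nat) set" where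
  "RR _ = {\<phi>. \<exists>(X :: 'a set) T. T \<in> X \<rightarrow> X \<and>
      (\<forall>n\<ge>1. finite {x \<in> X. (T ^^ n) x = x}) \<and>
      (\<lambda>n. real (num_periodic X T n) / real (\<phi> n)) \<longlonglongrightarrow> 1}"

lemma RR_transfer:
  assumes "\<phi> \<in> RR TYPE('a)"
  shows "\<phi> \<in> RR TYPE('b::infinite)"
proof -
  obtain X :: "'a set" and T where TX: "T \<in> X \<rightarrow> X"
    and fin: "\<And>n. n \<ge> 1 \<Longrightarrow> finite {x \<in> X. (T ^^ n) x = x}"
    and lim: "(\<lambda>n. real (num_periodic X T n) / real (\<phi> n)) \<longlonglongrightarrow> 1"
    using assms unfolding RR_def by auto
  define P where "P = (\<Union>n\<in>{1..}. {x \<in> X. (T ^^ n) x = x})"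
  have "countable P"
    unfolding P_def by (rule countable_UN) (use fin in \<open>auto intro!: countable_finite\<close>)
  obtain h :: "nat \<Rightarrow> 'b" where h: "inj h"
    using infinite_UNIV infinite_countable_subset by blast
  define g where "g = h \<circ> to_nat_on P"
  have g: "inj_on g P"
    unfolding g_def using \<open>countable P\<close> h
    by (intro comp_inj_on inj_on_to_nat_on) (auto intro: inj_on_subset)
  have TP: "T x \<in> P" if xP: "x \<in> P" for x
  proof -
    obtain n where n: "n \<ge> 1" "x \<in> X" "(T ^^ n) x = x"
      using xP unfolding P_def by auto
    then have "(T ^^ n) (T x) = T x"
      by (metis funpow_swap1)
    with n TX show ?thesis unfolding P_def by auto
  qed
  define S where "S = g \<circ> T \<circ> inv_into P g"
  have iter: "(T ^^ n) x \<in> P \<and> (S ^^ n) (g x) = g ((T ^^ n) x)" if "x \<in> P" for n x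
    using that by (induction n) (auto simp: S_def g TP)
  have per: "{y \<in> g ` P. (S ^^ n) y = y} = g ` {x \<in> X. (T ^^ n) x = x}" if "n \<ge> 1" for n
  proof -
    have "{y \<in> g ` P. (S ^^ n) y = y} = g ` {x \<in> P. (T ^^ n) x = x}"
      using iter inj_onD[OF g] by (auto intro!: imageI)
    also have "{x \<in> P. (T ^^ n) x = x} = {x \<in> X. (T ^^ n) x = x}"
      using that unfolding P_def by auto
    finally show ?thesis .
  qed
  have num: "num_periodic (g ` P) S n = num_periodic X T n" if "n \<ge> 1" for n
  proof -
    have "inj_on g {x \<in> X. (T ^^ n) x = x}"
      by (rule inj_on_subset[OF g]) (use that in \<open>auto simp: P_def\<close>)
    then show ?thesis
      unfolding num_periodic_def per[OF that] by (rule card_image)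
  qed
  have "(\<lambda>n. real (num_periodic (g ` P) S n) / real (\<phi> n)) \<longlonglongrightarrow> 1"
    by (rule Lim_transform_eventually[OF lim])
      (use num in \<open>auto intro!: eventually_sequentiallyI[of 1]\<close>)
  moreover have "S \<in> g ` P \<rightarrow> g ` P"
    unfolding S_def by (auto simp: g TP)
  moreover have "\<forall>n\<ge>1. finite {y \<in> g ` P. (S ^^ n) y = y}"
    by (simp add: per fin)
  ultimately show ?thesis unfolding RR_def by blast
qed

end

theory Submission
  imports Defs "HOL-Combinatorics.Cycles" "HOL-Computational_Algebra.Primes"
    "HOL-Analysis.Infinite_Sum" "HOL-Analysis.Summation_Tests" "HOL-Real_Asymp.Real_Asymp"
begin

text \<open>
  The points of least period \<open>d\<close> fall into cycles of length \<open>d\<close>, so if \<open>c d\<close> is the number of these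
  cycles, then the number of points fixed by \<open>T ^^ n\<close> is \<open>\<Sum>d | d dvd n. d * c d\<close>; conversely any
  function \<open>c\<close> arises from a disjoint union of cycles. Membership in \<open>RR\<close> is therefore a question
  about such divisor sums (\<open>RR_iff_orbit_counts\<close>).

  Obstructions come from restricting to a prime \<open>p\<close>, where the count is \<open>c 1 + p * c p\<close>. If
  the sequence is \<open>o(n)\<close>, this forces \<open>c p = 0\<close> for large \<open>p\<close>, so the counts along the primes are
  bounded and cannot follow a sequence that tends to infinity. For the sequence \<open>n\<close> itself it forces
  \<open>c p = 1\<close>; then the count at \<open>2 * p\<close> is \<open>p\<close> plus a multiple of \<open>2 * p\<close> up to a bounded error, which
  is never close to \<open>2 * p\<close>.

  For the positive results, suppose that the target \<open>\<psi> n\<close> is asymptotic to \<open>\<Sum>d | d dvd n. g d\<close> with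
  real \<open>g \<ge> 0\<close>. Taking \<open>c d = \<lfloor>g d / d\<rfloor>\<close> changes each summand by at most \<open>d\<close>, so the total
  error is at most the sum of the divisors of \<open>n\<close>, which is negligible when \<open>\<psi>\<close> grows faster than
  that sum (\<open>nat_floor_in_RR\<close>).

  \<^item> For \<open>\<psi> n = n powr \<alpha>\<close> with \<open>\<alpha> > 1\<close> there is an exact such \<open>g\<close>, Jordan's totient
    \<open>n powr \<alpha> * (\<Prod>p. 1 - p powr (- \<alpha>))\<close>, the product being over the primes that divide \<open>n\<close>.
    Both its non-negativity and its divisor sum are read off from the probability that a random
    integer with distribution proportional to \<open>k powr (- \<alpha>)\<close> is coprime to \<open>n\<close>.

  \<^item> For \<open>\<psi> n = \<beta> ^ n\<close> with \<open>\<beta> > 1\<close> the choice \<open>g d = \<beta> ^ d\<close> suffices, since all proper divisors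
    of \<open>n\<close> are at most \<open>n / 2\<close> and the summand at \<open>n\<close> dominates.
\<close>

section \<open>Counting periodic points by orbits\<close>

lemma least_power_dvd_imp_fixed:
  assumes "(T ^^ m) x = x" "m > 0" "least_power T x dvd n"
  shows "(T ^^ n) x = x"
proof -
  obtain q where q: "n = least_power T x * q"
    using assms(3) by blast
  have "((T ^^ least_power T x) ^^ q) x = x"
    by (induction q) (simp_all add: least_powerI(1)[OF assms(1,2)])
  then show ?thesis
    by (simp add: q funpow_mult mult.commute)
qed

text \<open>
  The orbits \<open>{x, T x, \<dots>, (T ^^ (d - 1)) x}\<close> partition these points into sets of size \<open>d\<close>. Although
  \<open>T\<close> need not be injective on \<open>X\<close>, it is so here, because \<open>T ^^ (d - i)\<close> undoes \<open>T ^^ i\<close> on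
  points of period \<open>d\<close>.
\<close>

lemma dvd_card_least_power_eq:
  assumes T: "T \<in> X \<rightarrow> X" and d: "d > 0"
    and fin: "finite {x \<in> X. (T ^^ d) x = x}"
  shows "d dvd card {x \<in> X. (T ^^ d) x = x \<and> least_power T x = d}"
proof -
  define A where "A = {x \<in> X. (T ^^ d) x = x \<and> least_power T x = d}"
  define orb where "orb x = (\<lambda>i. (T ^^ i) x) ` {..<d}" for x
  have finA: "finite A"
    using fin by (rule finite_subset[rotated]) (auto simp: A_def)
  have add: "(T ^^ i) ((T ^^ j) x) = (T ^^ (i + j)) x" for i j x
    by (simp add: funpow_add)
  have shift: "(T ^^ n) ((T ^^ i) x) = (T ^^ i) ((T ^^ n) x)" for n i x
    by (simp add: add add.commute)
  have mod_d: "(T ^^ i) x = (T ^^ (i mod d)) x" if "x \<in> A" for i x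
  proof -
    have "(T ^^ (d * (i div d))) x = x"
      by (rule least_power_dvd_imp_fixed[of d]) (use that d in \<open>auto simp: A_def\<close>)
    then have "(T ^^ (i mod d)) ((T ^^ (d * (i div d))) x) = (T ^^ (i mod d)) x"
      by simp
    then show ?thesis
      by (simp add: add)
  qed
  have wrap: "(T ^^ (d - i)) ((T ^^ i) x) = x" if "x \<in> A" "i < d" for i x
    using that by (simp add: A_def add)
  have closed: "(T ^^ i) x \<in> A" if x: "x \<in> A" and i: "i < d" for x i
  proof -
    have X: "(T ^^ i) x \<in> X"
      using x T by (induction i) (auto simp: A_def)
    have per: "(T ^^ n) ((T ^^ i) x) = (T ^^ i) x \<longleftrightarrow> (T ^^ n) x = x" for n
    proof
      assume "(T ^^ n) ((T ^^ i) x) = (T ^^ i) x"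
      then have "(T ^^ n) ((T ^^ (d - i)) ((T ^^ i) x)) = (T ^^ (d - i)) ((T ^^ i) x)"
        using shift[of n "d - i"] by simp
      then show "(T ^^ n) x = x"
        by (simp add: wrap x i)
    qed (metis shift)
    show ?thesis
      using x X unfolding A_def by (simp add: per least_power_def)
  qed
  have orb_eq: "orb y = orb x" if x: "x \<in> A" and y: "y \<in> orb x" for x y
  proof -
    have sub: "orb ((T ^^ i) z) \<subseteq> orb z" if "z \<in> A" for z i
    proof
      fix w assume "w \<in> orb ((T ^^ i) z)"
      then obtain j where "w = (T ^^ (j + i)) z"
        by (auto simp: orb_def funpow_add)
      then have "w = (T ^^ ((j + i) mod d)) z"
        using mod_d[OF that, of "j + i"] by (rule trans)
      then show "w \<in> orb z"
        using d by (auto simp: orb_def)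
    qed
    obtain i where i: "i < d" "y = (T ^^ i) x"
      using y by (auto simp: orb_def)
    show ?thesis
      using sub[OF x, of i] sub[OF closed[OF x i(1)], of "d - i"] i wrap[OF x i(1)] by simp
  qed
  have inj: "inj_on (\<lambda>i. (T ^^ i) x) {..<d}" if x: "x \<in> A" for x
  proof -
    have "\<not> i < j" if ij: "i < d" "j < d" "(T ^^ i) x = (T ^^ j) x" for i j
    proof
      assume "i < j"
      have "(T ^^ (j - i)) ((T ^^ i) x) = (T ^^ i) x"
        using ij(3) \<open>i < j\<close> add[of "j - i" i x] by simp
      moreover have "least_power T ((T ^^ i) x) = d"
        using closed[OF x ij(1)] by (simp add: A_def)
      ultimately have "d dvd j - i"
        using least_power_minimal by metis
      then show False
        using \<open>i < j\<close> \<open>j < d\<close> by (auto dest: dvd_imp_le)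
    qed
    then show ?thesis
      by (intro inj_onI) (metis lessThan_iff linorder_neqE_nat)
  qed
  have self: "x \<in> orb x" for x
    using d by (force simp: orb_def)
  have cover: "\<Union> (orb ` A) = A"
    using closed self by (fastforce simp: orb_def)
  have "d * card (orb ` A) = card (\<Union> (orb ` A))"
  proof (rule card_partition)
    fix C assume "C \<in> orb ` A"
    then show "card C = d"
      using inj by (auto simp: orb_def card_image)
  next
    fix C D assume "C \<in> orb ` A" "D \<in> orb ` A" "C \<noteq> D"
    then show "C \<inter> D = {}"
      using orb_eq by blast
  qed (use finA cover in auto)
  then have "card A = d * card (orb ` A)"
    by (simp only: cover)
  then have "d dvd card A"
    by (rule dvdI)
  then show ?thesis
    unfolding A_def .
qed

lemma num_periodic_eq_sum_orbits:
  assumes T: "T \<in> X \<rightarrow> X" and fin: "\<And>n. n \<ge> 1 \<Longrightarrow> finite {x \<in> X. (T ^^ n) x = x}"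
  obtains c where "\<And>n. n \<ge> 1 \<Longrightarrow> num_periodic X T n = (\<Sum>d | d dvd n. d * c d)"
proof
  define A where "A d = {x \<in> X. (T ^^ d) x = x \<and> least_power T x = d}" for d
  fix n :: nat assume n: "n \<ge> 1"
  have Un: "{x \<in> X. (T ^^ n) x = x} = (\<Union>d \<in> {d. d dvd n}. A d)"
  proof (intro equalityI subsetI)
    fix x assume "x \<in> {x \<in> X. (T ^^ n) x = x}"
    with n show "x \<in> (\<Union>d \<in> {d. d dvd n}. A d)"
      using least_powerI(1)[of n T x] least_power_minimal[of n T x] by (auto simp: A_def)
  next
    fix x assume "x \<in> (\<Union>d \<in> {d. d dvd n}. A d)"
    then obtain d where "d dvd n" "x \<in> A d" by blast
    with n show "x \<in> {x \<in> X. (T ^^ n) x = x}"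
      using least_power_dvd_imp_fixed[of d T x n] by (auto simp: A_def dvd_pos_nat)
  qed
  have "num_periodic X T n = (\<Sum>d | d dvd n. card (A d))"
    unfolding num_periodic_def Un
  proof (rule card_UN_disjoint)
    show "\<forall>d \<in> {d. d dvd n}. finite (A d)"
    proof
      fix d assume "d \<in> {d. d dvd n}"
      then have "d \<ge> 1" using n by (auto simp: Suc_le_eq dvd_pos_nat)
      then show "finite (A d)"
        using fin[of d] by (auto simp: A_def elim: rev_finite_subset)
    qed
  qed (use n in \<open>auto simp: A_def\<close>)
  also have "\<dots> = (\<Sum>d | d dvd n. d * (card (A d) div d))"
  proof (intro sum.cong refl)
    fix d assume "d \<in> {d. d dvd n}"
    then have "d \<ge> 1" using n by (auto simp: Suc_le_eq dvd_pos_nat)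
    then have "d dvd card (A d)"
      unfolding A_def using dvd_card_least_power_eq[OF T _ fin[of d]] by simp
    then show "card (A d) = d * (card (A d) div d)" by simp
  qed
  finally show "num_periodic X T n = (\<Sum>d | d dvd n. d * (card (A d) div d))" .
qed

text \<open>
  The system consists of \<open>c d\<close> disjoint cycles of length \<open>d\<close> for every \<open>d\<close>: the triple \<open>(d, k, j)\<close> is
  position \<open>j\<close> on the \<open>k\<close>-th cycle of length \<open>d\<close>.
\<close>

lemma orbit_counts_realizable:
  fixes c :: "nat \<Rightarrow> nat"
  obtains X :: "(nat \<times> nat \<times> nat) set" and T where "T \<in> X \<rightarrow> X"
    "\<And>n. n \<ge> 1 \<Longrightarrow> finite {x \<in> X. (T ^^ n) x = x}"
    "\<And>n. n \<ge> 1 \<Longrightarrow> num_periodic X T n = (\<Sum>d | d dvd n. d * c d)"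
proof
  define X where "X = {(d, k, j). k < c d \<and> j < d}"
  define T where "T = (\<lambda>(d, k, j). (d, k :: nat, Suc j mod d))"
  show "T \<in> X \<rightarrow> X"
    by (auto simp: X_def T_def)
  have iter: "(T ^^ n) (d, k, j) = (d, k, (j + n) mod d)" if "j < d" for n d k j
    using that by (induction n) (auto simp: T_def mod_Suc_eq)
  have fixed: "(j + n) mod d = j \<longleftrightarrow> d dvd n" if "j < d" for j n d :: nat
  proof -
    have "(j + n) mod d = j \<longleftrightarrow> (j + n) mod d = j mod d" using that by simp
    also have "\<dots> \<longleftrightarrow> d dvd n" by (subst mod_eq_dvd_iff_nat) auto
    finally show ?thesis .
  qed
  have eq: "{x \<in> X. (T ^^ n) x = x} = (SIGMA d:{d. d dvd n}. {..<c d} \<times> {..<d})" for n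
    by (auto simp: X_def iter fixed)
  fix n :: nat assume n: "n \<ge> 1"
  then have fd: "finite {d. d dvd n}" by simp
  show "finite {x \<in> X. (T ^^ n) x = x}"
    unfolding eq using fd by blast
  show "num_periodic X T n = (\<Sum>d | d dvd n. d * c d)"
    unfolding num_periodic_def eq using fd by (subst card_SigmaI) (auto simp: mult.commute)
qed

text \<open>
  This removes the dynamics: everything below is about divisor sums of sequences of natural numbers.
\<close>

theorem RR_iff_orbit_counts:
  "\<phi> \<in> RR TYPE('a::infinite) \<longleftrightarrow>
     (\<exists>c :: nat \<Rightarrow> nat. (\<lambda>n. real (\<Sum>d | d dvd n. d * c d) / real (\<phi> n)) \<longlonglongrightarrow> 1)"
proof
  assume "\<phi> \<in> RR TYPE('a)"
  then obtain X :: "'a set" and T where XT: "T \<in> X \<rightarrow> X"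
    "\<And>n. n \<ge> 1 \<Longrightarrow> finite {x \<in> X. (T ^^ n) x = x}"
    and lim: "(\<lambda>n. real (num_periodic X T n) / real (\<phi> n)) \<longlonglongrightarrow> 1"
    unfolding RR_def by auto
  obtain c where c: "\<And>n. n \<ge> 1 \<Longrightarrow> num_periodic X T n = (\<Sum>d | d dvd n. d * c d)"
    using num_periodic_eq_sum_orbits[OF XT] by blast
  have "(\<lambda>n. real (\<Sum>d | d dvd n. d * c d) / real (\<phi> n)) \<longlonglongrightarrow> 1"
    by (rule Lim_transform_eventually[OF lim])
      (use c in \<open>auto intro!: eventually_sequentiallyI[of 1]\<close>)
  then show "\<exists>c :: nat \<Rightarrow> nat. (\<lambda>n. real (\<Sum>d | d dvd n. d * c d) / real (\<phi> n)) \<longlonglongrightarrow> 1"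
    by (rule exI[of _ c])
next
  assume "\<exists>c :: nat \<Rightarrow> nat. (\<lambda>n. real (\<Sum>d | d dvd n. d * c d) / real (\<phi> n)) \<longlonglongrightarrow> 1"
  then obtain c :: "nat \<Rightarrow> nat"
    where lim: "(\<lambda>n. real (\<Sum>d | d dvd n. d * c d) / real (\<phi> n)) \<longlonglongrightarrow> 1" ..
  obtain X :: "(nat \<times> nat \<times> nat) set" and T where XT: "T \<in> X \<rightarrow> X"
    "\<And>n. n \<ge> 1 \<Longrightarrow> finite {x \<in> X. (T ^^ n) x = x}"
    "\<And>n. n \<ge> 1 \<Longrightarrow> num_periodic X T n = (\<Sum>d | d dvd n. d * c d)"
    by (rule orbit_counts_realizable[of c]) blast
  have "(\<lambda>n. real (num_periodic X T n) / real (\<phi> n)) \<longlonglongrightarrow> 1"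
    by (rule Lim_transform_eventually[OF lim])
      (use XT(3) in \<open>auto intro!: eventually_sequentiallyI[of 1]\<close>)
  then have "\<phi> \<in> RR TYPE(nat \<times> nat \<times> nat)"
    unfolding RR_def using XT(1,2) by blast
  then show "\<phi> \<in> RR TYPE('a)"
    by (rule RR_transfer)
qed

section \<open>Sequences of at most linear growth\<close>

lemma eventually_sequentially_prime:
  assumes "eventually P sequentially"
  obtains p :: nat where "prime p" "P p"
proof -
  obtain N where N: "\<And>n. n \<ge> N \<Longrightarrow> P n"
    using assms by (auto simp: eventually_sequentially)
  obtain p where "prime p" "p > N"
    using bigger_prime by blast
  with N that show ?thesis by simp
qed

lemma sum_divisors_prime:
  assumes "prime (p :: nat)"
  shows "(\<Sum>d | d dvd p. f d) = f 1 + f p"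
proof -
  have "{d. d dvd p} = {1, p}"
    using assms by (auto simp: prime_nat_iff)
  then show ?thesis
    using prime_gt_1_nat[OF assms] by simp
qed

lemma sum_divisors_twice_prime:
  assumes p: "prime (p :: nat)" "p > 2"
  shows "(\<Sum>d | d dvd 2 * p. f d) = f 1 + f 2 + f p + f (2 * p)"
proof -
  have "d \<in> {1, 2, p, 2 * p}" if "d dvd 2 * p" for d
  proof -
    obtain x y where xy: "d = x * y" "x dvd 2" "y dvd p"
      using division_decomp[OF \<open>d dvd 2 * p\<close>] by blast
    have "x \<in> {1, 2}" "y \<in> {1, p}"
      using xy p two_is_prime_nat by (auto simp: prime_nat_iff)
    with xy(1) show ?thesis by auto
  qed
  then have "{d. d dvd 2 * p} = {1, 2, p, 2 * p}"
    by auto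
  then show ?thesis
    using p(2) by (simp add: add.assoc)
qed

text \<open>
  At a large prime \<open>p\<close> the count \<open>c 1 + p * c p\<close> is at most \<open>2 * \<phi> p < p\<close>, so \<open>c p = 0\<close> and the
  count is just \<open>c 1\<close>; but it also exceeds \<open>\<phi> p / 2\<close>, which tends to infinity.
\<close>

theorem sublinear_not_in_RR:
  fixes \<phi> :: "nat \<Rightarrow> nat"
  assumes top: "filterlim \<phi> at_top sequentially"
    and sub: "(\<lambda>n. real (\<phi> n) / real n) \<longlonglongrightarrow> 0"
  shows "\<phi> \<notin> RR TYPE('a::infinite)"
proof
  assume "\<phi> \<in> RR TYPE('a)"
  then obtain c :: "nat \<Rightarrow> nat"
    where lim: "(\<lambda>n. real (\<Sum>d | d dvd n. d * c d) / real (\<phi> n)) \<longlonglongrightarrow> 1"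
    unfolding RR_iff_orbit_counts by blast
  have "eventually (\<lambda>n. 1/2 < real (\<Sum>d | d dvd n. d * c d) / real (\<phi> n)) sequentially"
    "eventually (\<lambda>n. real (\<Sum>d | d dvd n. d * c d) / real (\<phi> n) < 2) sequentially"
    by (intro order_tendstoD[OF lim]; simp)+
  moreover have "eventually (\<lambda>n. real (\<phi> n) / real n < 1/2) sequentially"
    by (intro order_tendstoD[OF sub]) simp
  moreover have "eventually (\<lambda>n. \<phi> n \<ge> 2 * c 1 + 1) sequentially"
    using top by (simp add: filterlim_at_top)
  ultimately have "eventually (\<lambda>n. 1/2 < real (\<Sum>d | d dvd n. d * c d) / real (\<phi> n) \<and>
      real (\<Sum>d | d dvd n. d * c d) / real (\<phi> n) < 2 \<and>
      real (\<phi> n) / real n < 1/2 \<and> \<phi> n \<ge> 2 * c 1 + 1) sequentially"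
    by eventually_elim blast
  then obtain p where p: "prime p" and bounds: "1/2 < real (\<Sum>d | d dvd p. d * c d) / real (\<phi> p)"
      "real (\<Sum>d | d dvd p. d * c d) / real (\<phi> p) < 2"
      "real (\<phi> p) / real p < 1/2" "\<phi> p \<ge> 2 * c 1 + 1"
    by (rule eventually_sequentially_prime) blast
  have sum: "(\<Sum>d | d dvd p. d * c d) = c 1 + p * c p"
    by (subst sum_divisors_prime[OF p]) simp
  have pos: "real (\<phi> p) > 0" "real p > 0"
    using bounds(4) prime_gt_0_nat[OF p] by auto
  have "real (c 1 + p * c p) < 2 * real (\<phi> p)" "real (\<phi> p) < real p / 2"
    using bounds(2,3) pos unfolding sum by (simp_all add: field_simps)
  then have "real (c 1 + p * c p) < real p" by simp
  then have "p * c p < p" by linarith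
  then have "c p = 0" by simp
  then show False
    using bounds(1,4) pos unfolding sum by (simp add: field_simps)
qed

text \<open>
  For a large prime \<open>p\<close> the count at \<open>p\<close> forces exactly one cycle of length \<open>p\<close>. This cycle
  contributes half of the desired \<open>2 * p\<close> points of period \<open>2 * p\<close>, while cycles of length \<open>2 * p\<close>
  contribute either nothing or at least all of it.
\<close>

theorem linear_not_in_RR: "(\<lambda>n. n) \<notin> RR TYPE('a::infinite)"
proof
  assume "(\<lambda>n. n) \<in> RR TYPE('a)"
  then obtain c :: "nat \<Rightarrow> nat"
    where lim: "(\<lambda>n. real (\<Sum>d | d dvd n. d * c d) / real n) \<longlonglongrightarrow> 1"
    unfolding RR_iff_orbit_counts by blast
  define near where "near n \<longleftrightarrow> 7/8 < real (\<Sum>d | d dvd n. d * c d) / real n \<and>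
      real (\<Sum>d | d dvd n. d * c d) / real n < 9/8" for n
  have "eventually near sequentially"
    unfolding near_def[abs_def] by (intro eventually_conj order_tendstoD[OF lim]) simp_all
  then obtain N where N: "\<And>n. n \<ge> N \<Longrightarrow> near n"
    by (auto simp: eventually_sequentially)
  \<comment> \<open>The term \<open>8 * (c 1 + 2 * c 2)\<close> makes the contribution of the fixed points and the
    \<open>2\<close>-cycles at most \<open>p / 8\<close>, and \<open>3\<close> excludes \<open>p = 2\<close>.\<close>
  have "eventually (\<lambda>n. n \<ge> N + 8 * (c 1 + 2 * c 2) + 3) sequentially"
    by (rule eventually_ge_at_top)
  then obtain p where p: "prime p" "p \<ge> N + 8 * (c 1 + 2 * c 2) + 3"
    by (rule eventually_sequentially_prime)
  have sum: "(\<Sum>d | d dvd p. d * c d) = c 1 + p * c p"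
    by (subst sum_divisors_prime[OF p(1)]) simp
  have "near p" using N p(2) by simp
  then have 1: "7/8 * real p < real (c 1 + p * c p)" "real (c 1 + p * c p) < 9/8 * real p"
    using p(2) unfolding near_def sum by (simp_all add: field_simps)
  have "c p \<noteq> 0"
    using 1(1) p(2) by (intro notI) simp
  moreover have "p * c p < p * 2"
    using 1(2) p(2) by linarith
  ultimately have cp: "c p = 1" by simp
  have sum2: "(\<Sum>d | d dvd 2 * p. d * c d) = c 1 + 2 * c 2 + p + 2 * p * c (2 * p)"
    using p cp by (subst sum_divisors_twice_prime) simp_all
  have "near (2 * p)" using N p(2) by simp
  then have 2: "7/4 * real p < real (c 1 + 2 * c 2 + p + 2 * p * c (2 * p))"
      "real (c 1 + 2 * c 2 + p + 2 * p * c (2 * p)) < 9/4 * real p"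
    using p(2) unfolding near_def sum2 by (simp_all add: field_simps)
  have "2 * p * c (2 * p) < 2 * p * 1"
    using 2(2) p(2) by linarith
  then have "c (2 * p) = 0"
    using p(2) by simp
  then show False
    using 2(1) p(2) by simp
qed

section \<open>Rounding a non-negative divisor sum\<close>

lemma tendsto_nat_floor_ratio:
  fixes \<psi> :: "nat \<Rightarrow> real"
  assumes "filterlim \<psi> at_top sequentially"
  shows "(\<lambda>n. real (nat \<lfloor>\<psi> n\<rfloor>) / \<psi> n) \<longlonglongrightarrow> 1"
proof (rule tendsto_sandwich)
  have pos: "eventually (\<lambda>n. \<psi> n \<ge> 1) sequentially"
    using assms by (simp add: filterlim_at_top)
  show "eventually (\<lambda>n. 1 - inverse (\<psi> n) \<le> real (nat \<lfloor>\<psi> n\<rfloor>) / \<psi> n) sequentially"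
    using pos
  proof eventually_elim
    case (elim n)
    have "\<psi> n - 1 \<le> real (nat \<lfloor>\<psi> n\<rfloor>)" by linarith
    then have "(\<psi> n - 1) / \<psi> n \<le> real (nat \<lfloor>\<psi> n\<rfloor>) / \<psi> n"
      using elim by (intro divide_right_mono) simp_all
    then show ?case using elim by (simp add: diff_divide_distrib inverse_eq_divide)
  qed
  show "eventually (\<lambda>n. real (nat \<lfloor>\<psi> n\<rfloor>) / \<psi> n \<le> 1) sequentially"
    using pos
  proof eventually_elim
    case (elim n)
    have "real (nat \<lfloor>\<psi> n\<rfloor>) \<le> \<psi> n" using elim by linarith
    then show ?case using elim by (simp add: field_simps)
  qed
  have "(\<lambda>n. inverse (\<psi> n)) \<longlonglongrightarrow> 0"
    using tendsto_inverse_0_at_top[OF assms] .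
  then show "(\<lambda>n. 1 - inverse (\<psi> n)) \<longlonglongrightarrow> 1"
    using tendsto_diff[OF tendsto_const, of "\<lambda>n. inverse (\<psi> n)" 0 sequentially 1] by simp
qed simp

lemma rounded_divisor_sum_bounds:
  fixes g :: "nat \<Rightarrow> real"
  assumes g: "\<And>d. d > 0 \<Longrightarrow> g d \<ge> 0" and n: "n > 0"
  shows "real (\<Sum>d | d dvd n. d * nat \<lfloor>g d / d\<rfloor>) \<le> (\<Sum>d | d dvd n. g d)"
    and "(\<Sum>d | d dvd n. g d) - real (\<Sum>d | d dvd n. d) \<le> real (\<Sum>d | d dvd n. d * nat \<lfloor>g d / d\<rfloor>)"
proof -
  have d: "real (d * nat \<lfloor>g d / d\<rfloor>) \<le> g d" "g d - real d \<le> real (d * nat \<lfloor>g d / d\<rfloor>)"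
    if "d dvd n" for d
  proof -
    have pos: "d > 0" using that n by (simp add: dvd_pos_nat)
    then have "g d / d \<ge> 0" using g by simp
    then have "real (nat \<lfloor>g d / d\<rfloor>) \<le> g d / d" "g d / d - 1 \<le> real (nat \<lfloor>g d / d\<rfloor>)"
      by linarith+
    with pos show "real (d * nat \<lfloor>g d / d\<rfloor>) \<le> g d" "g d - real d \<le> real (d * nat \<lfloor>g d / d\<rfloor>)"
      by (simp_all add: field_simps)
  qed
  show "real (\<Sum>d | d dvd n. d * nat \<lfloor>g d / d\<rfloor>) \<le> (\<Sum>d | d dvd n. g d)"
    unfolding of_nat_sum by (intro sum_mono) (use d(1) in auto)
  have "(\<Sum>d | d dvd n. g d - real d) \<le> (\<Sum>d | d dvd n. real (d * nat \<lfloor>g d / d\<rfloor>))"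
    by (intro sum_mono) (use d(2) in auto)
  then show "(\<Sum>d | d dvd n. g d) - real (\<Sum>d | d dvd n. d) \<le> real (\<Sum>d | d dvd n. d * nat \<lfloor>g d / d\<rfloor>)"
    by (simp add: sum_subtractf)
qed

text \<open>
  A non-negative real divisor sum can be rounded to integral orbit counts at the expense of the sum of
  all divisors of \<open>n\<close>, so it is enough that this sum is negligible compared with the target.
\<close>

theorem nat_floor_in_RR:
  fixes g \<psi> :: "nat \<Rightarrow> real"
  assumes g: "\<And>d. d > 0 \<Longrightarrow> g d \<ge> 0"
    and top: "filterlim \<psi> at_top sequentially"
    and sum: "(\<lambda>n. (\<Sum>d | d dvd n. g d) / \<psi> n) \<longlonglongrightarrow> 1"
    and sigma: "(\<lambda>n. real (\<Sum>d | d dvd n. d) / \<psi> n) \<longlonglongrightarrow> 0"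
  shows "(\<lambda>n. nat \<lfloor>\<psi> n\<rfloor>) \<in> RR TYPE('a::infinite)"
proof -
  define f where "f n = (\<Sum>d | d dvd n. d * nat \<lfloor>g d / d\<rfloor>)" for n
  have pos: "eventually (\<lambda>n. n > 0 \<and> \<psi> n > 0) sequentially"
    using top by (intro eventually_conj eventually_gt_at_top) (simp add: filterlim_at_top_dense)
  have "(\<lambda>n. real (f n) / \<psi> n) \<longlonglongrightarrow> 1"
  proof (rule tendsto_sandwich[OF _ _ _ sum])
    show "eventually (\<lambda>n. (\<Sum>d | d dvd n. g d) / \<psi> n - real (\<Sum>d | d dvd n. d) / \<psi> n
        \<le> real (f n) / \<psi> n) sequentially"
      using pos by eventually_elim
        (use rounded_divisor_sum_bounds(2)[OF g] in
          \<open>simp add: f_def divide_right_mono flip: diff_divide_distrib\<close>)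
    show "eventually (\<lambda>n. real (f n) / \<psi> n \<le> (\<Sum>d | d dvd n. g d) / \<psi> n) sequentially"
      using pos by eventually_elim
        (use rounded_divisor_sum_bounds(1)[OF g] in \<open>simp add: f_def divide_right_mono\<close>)
    show "(\<lambda>n. (\<Sum>d | d dvd n. g d) / \<psi> n - real (\<Sum>d | d dvd n. d) / \<psi> n) \<longlonglongrightarrow> 1"
      using tendsto_diff[OF sum sigma] by simp
  qed
  then have "(\<lambda>n. (real (f n) / \<psi> n) / (real (nat \<lfloor>\<psi> n\<rfloor>) / \<psi> n)) \<longlonglongrightarrow> 1 / 1"
    by (intro tendsto_divide tendsto_nat_floor_ratio[OF top]) simp_all
  then have "(\<lambda>n. real (f n) / real (nat \<lfloor>\<psi> n\<rfloor>)) \<longlonglongrightarrow> 1 / 1"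
    by (rule Lim_transform_eventually) (use pos in eventually_elim, simp)
  then have "(\<lambda>n. real (f n) / real (nat \<lfloor>\<psi> n\<rfloor>)) \<longlonglongrightarrow> 1"
    by simp
  then show ?thesis
    unfolding RR_iff_orbit_counts f_def by (rule exI[of _ "\<lambda>d. nat \<lfloor>g d / d\<rfloor>"])
qed

section \<open>Powers with exponent above one\<close>

lemma sum_divisors_div:
  assumes "n > 0"
  shows "(\<Sum>d | d dvd n. f (n div d)) = (\<Sum>d | d dvd (n :: nat). f d)"
  using assms
  by (intro sum.reindex_bij_witness[of _ "(div) n" "(div) n"]) (auto elim: dvdE)

text \<open>
  Give each positive integer \<open>k\<close> the weight \<open>k powr (- \<alpha>)\<close>, which has finite total \<open>Z\<close>. The integers
  with \<open>gcd k n = n div d\<close> are the multiples \<open>k = (n div d) * j\<close> with \<open>j\<close> coprime to \<open>d\<close>, so their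
  weight is \<open>(n div d) powr (- \<alpha>)\<close> times the weight of the integers coprime to \<open>d\<close>. Grouping the
  positive integers by their greatest common divisor with \<open>n\<close> expresses \<open>Z\<close> as the sum of these
  weights over \<open>d dvd n\<close>, and multiplying by \<open>n powr \<alpha> / Z\<close> gives the identity, with
  \<open>g d\<close> equal to \<open>d powr \<alpha>\<close> times the proportion of the weight carried by integers coprime to \<open>d\<close>.
\<close>

lemma powr_eq_divisor_sum:
  fixes \<alpha> :: real
  assumes \<alpha>: "\<alpha> > 1"
  obtains g :: "nat \<Rightarrow> real" where "\<And>d. g d \<ge> 0"
    "\<And>n. n > 0 \<Longrightarrow> (\<Sum>d | d dvd n. g d) = real n powr \<alpha>"
proof
  define w where "w k = real k powr (-\<alpha>)" for k
  define C where "C d = {k :: nat. k > 0 \<and> coprime k d}" for d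
  define Z where "Z = infsum w {0<..}"
  define g where "g d = real d powr \<alpha> * infsum w (C d) / Z" for d
  have "summable w"
    unfolding w_def using \<alpha> by (subst summable_real_powr_iff) simp
  then have "w summable_on UNIV"
    by (subst summable_on_UNIV_nonneg_real_iff) (auto simp: w_def)
  then have summable: "w summable_on A" for A
    by (rule summable_on_subset_banach) simp
  have w0: "w k \<ge> 0" for k
    by (simp add: w_def)
  have "infsum w {1} \<le> Z"
    unfolding Z_def by (intro infsum_mono_neutral summable) (auto simp: w0)
  then have Z: "Z > 0"
    by (simp add: w_def)
  show "g d \<ge> 0" for d
    unfolding g_def using Z by (auto intro!: mult_nonneg_nonneg divide_nonneg_pos infsum_nonneg w0)
  fix n :: nat assume n: "n > 0"
  define B where "B d = {k. k > 0 \<and> gcd k n = n div d}" for d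
  have B: "infsum w (B d) = g d * Z / real n powr \<alpha>" if d: "d dvd n" for d
  proof -
    obtain e where e: "n = e * d" using d by (metis dvd_def mult.commute)
    have pos: "e > 0" "d > 0" using n e by auto
    have "B d = (\<lambda>j. e * j) ` C d"
    proof (intro equalityI subsetI)
      fix k assume "k \<in> B d"
      then have k: "k > 0" "gcd k (e * d) = e" using pos by (auto simp: B_def e)
      then obtain j where j: "k = e * j" by (metis gcd_dvd1 dvd_def)
      have "e * gcd j d = e" using k(2) by (simp add: j gcd_mult_distrib_nat)
      then have "coprime j d" using pos by (simp add: coprime_iff_gcd_eq_1)
      then show "k \<in> (\<lambda>j. e * j) ` C d" using k(1) j by (auto simp: C_def)
    next
      fix k assume "k \<in> (\<lambda>j. e * j) ` C d"
      then obtain j where j: "k = e * j" "j > 0" "coprime j d" by (auto simp: C_def)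
      have "gcd (e * j) (e * d) = e * gcd j d" by (simp add: gcd_mult_distrib_nat)
      with j pos show "k \<in> B d" by (auto simp: B_def e coprime_iff_gcd_eq_1)
    qed
    then have "infsum w (B d) = infsum (w \<circ> (\<lambda>j. e * j)) (C d)"
      using pos by (simp add: infsum_reindex inj_on_def)
    also have "w \<circ> (\<lambda>j. e * j) = (\<lambda>j. real e powr (-\<alpha>) * w j)"
      by (auto simp: w_def powr_mult)
    also have "infsum (\<lambda>j. real e powr (-\<alpha>) * w j) (C d) = real e powr (-\<alpha>) * infsum w (C d)"
      by (rule infsum_cmult_right')
    also have "\<dots> = g d * Z / real n powr \<alpha>"
      using Z pos by (simp add: g_def e powr_mult powr_minus field_simps)
    finally show ?thesis .
  qed
  have "{0<..} = (\<Union>d \<in> {d. d dvd n}. B d)"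
  proof (intro equalityI subsetI)
    fix k :: nat assume k: "k \<in> {0<..}"
    have "n div (n div gcd k n) = gcd k n"
      using n by (simp add: div_div_eq_right)
    moreover have "n div gcd k n dvd n"
      by (metis dvd_triv_left dvd_mult_div_cancel gcd_dvd2 mult.commute)
    ultimately show "k \<in> (\<Union>d \<in> {d. d dvd n}. B d)"
      using k by (auto simp: B_def intro!: exI[of _ "n div gcd k n"])
  qed (auto simp: B_def)
  then have "Z = infsum w (\<Union>d \<in> {d. d dvd n}. B d)"
    by (simp add: Z_def)
  also have "\<dots> = (\<Sum>d | d dvd n. infsum w (B d))"
  proof (rule sum_infsum[symmetric])
    fix d d' assume "d \<in> {d. d dvd n}" "d' \<in> {d. d dvd n}" "d \<noteq> d'"
    then have "n div d \<noteq> n div d'"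
      using n by (metis dvd_div_mult_self mem_Collect_eq mult_cancel_left dvd_mult_div_cancel
          not_less0 dvd_0_left_iff)
    then show "B d \<inter> B d' = {}"
      by (auto simp: B_def)
  qed (use n summable in auto)
  also have "\<dots> = (\<Sum>d | d dvd n. g d) * Z / real n powr \<alpha>"
    by (simp add: B sum_distrib_right sum_divide_distrib)
  finally show "(\<Sum>d | d dvd n. g d) = real n powr \<alpha>"
    using Z n by (simp add: field_simps)
qed

text \<open>
  Replacing \<open>d\<close> by \<open>n div d\<close> turns the sum into one over \<open>n / d \<le> (n / d) powr s\<close>, a part of a convergent
  series times \<open>n powr s\<close>.
\<close>

lemma divisor_sum_le_powr:
  fixes s :: real
  assumes s: "s > 1" and n: "n > 0"
  shows "real (\<Sum>d | d dvd n. d) \<le> (\<Sum>k. real k powr (-s)) * real n powr s"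
proof -
  have summable: "summable (\<lambda>k. real k powr (-s))"
    using s by (subst summable_real_powr_iff) simp
  have "real (\<Sum>d | d dvd n. d) = (\<Sum>d | d dvd n. real (n div d))"
    using sum_divisors_div[OF n, of real] by simp
  also have "\<dots> \<le> (\<Sum>d | d dvd n. real d powr (-s) * real n powr s)"
  proof (rule sum_mono)
    fix d assume "d \<in> {d. d dvd n}"
    then have d: "d dvd n" "d > 0" "d \<le> n" using n by (auto intro: dvd_pos_nat dvd_imp_le)
    have "real (n div d) = (real n / real d) powr 1"
      using d n by (simp add: real_of_nat_div)
    also have "\<dots> \<le> (real n / real d) powr s"
      using s d by (intro powr_mono) simp_all
    also have "\<dots> = real d powr (-s) * real n powr s"
      using d by (simp add: powr_divide powr_minus field_simps)
    finally show "real (n div d) \<le> real d powr (-s) * real n powr s" .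
  qed
  also have "\<dots> \<le> (\<Sum>k. real k powr (-s)) * real n powr s"
    unfolding sum_distrib_right[symmetric]
    using n by (intro mult_right_mono sum_le_suminf summable) auto
  finally show ?thesis .
qed

text \<open>
  Any exponent strictly between \<open>1\<close> and \<open>\<alpha>\<close> in the preceding bound leaves a negative power of \<open>n\<close>.
\<close>

lemma divisor_sum_over_powr_tendsto_0:
  fixes \<alpha> :: real
  assumes \<alpha>: "\<alpha> > 1"
  shows "(\<lambda>n. real (\<Sum>d | d dvd n. d) / real n powr \<alpha>) \<longlonglongrightarrow> 0"
proof -
  define s where "s = (1 + \<alpha>) / 2"
  have s: "s > 1" "s < \<alpha>" using \<alpha> by (auto simp: s_def)
  define K where "K = (\<Sum>k. real k powr (-s))"
  show ?thesis
  proof (rule tendsto_sandwich[OF _ _ tendsto_const])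
    show "eventually (\<lambda>n. real (\<Sum>d | d dvd n. d) / real n powr \<alpha> \<le> K * real n powr (s - \<alpha>)) sequentially"
      using eventually_gt_at_top[of 0]
    proof eventually_elim
      case (elim n)
      have "real (\<Sum>d | d dvd n. d) / real n powr \<alpha> \<le> K * real n powr s / real n powr \<alpha>"
        unfolding K_def by (intro divide_right_mono divisor_sum_le_powr s elim) simp
      then show ?case by (simp add: powr_diff)
    qed
    show "(\<lambda>n. K * real n powr (s - \<alpha>)) \<longlonglongrightarrow> 0"
      using s(2) by real_asymp
  qed (simp add: sum_nonneg)
qed

theorem powr_in_RR:
  fixes \<alpha> :: real
  assumes \<alpha>: "\<alpha> > 1"
  shows "(\<lambda>n. nat \<lfloor>real n powr \<alpha>\<rfloor>) \<in> RR TYPE('a::infinite)"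
proof -
  obtain g :: "nat \<Rightarrow> real" where g: "\<And>d. g d \<ge> 0"
    "\<And>n. n > 0 \<Longrightarrow> (\<Sum>d | d dvd n. g d) = real n powr \<alpha>"
    using powr_eq_divisor_sum[OF \<alpha>] by blast
  show ?thesis
  proof (rule nat_floor_in_RR)
    show "filterlim (\<lambda>n. real n powr \<alpha>) at_top sequentially"
      using \<alpha> by real_asymp
    show "(\<lambda>n. (\<Sum>d | d dvd n. g d) / real n powr \<alpha>) \<longlonglongrightarrow> 1"
      by (rule tendsto_eventually) (auto simp: g(2) intro!: eventually_sequentiallyI[of 1])
  qed (use g(1) divisor_sum_over_powr_tendsto_0[OF \<alpha>] in auto)
qed

section \<open>Geometric sequences\<close>

text \<open>
  A proper divisor of \<open>n\<close> is at most \<open>n / 2\<close>, and there are fewer than \<open>n\<close> of them.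
\<close>

lemma power_divisor_sum_bounds:
  fixes \<beta> :: real
  assumes \<beta>: "\<beta> \<ge> 1" and n: "n > 0"
  shows "\<beta> ^ n \<le> (\<Sum>d | d dvd n. \<beta> ^ d)"
    and "(\<Sum>d | d dvd n. \<beta> ^ d) \<le> \<beta> ^ n + real n * \<beta> powr (real n / 2)"
proof -
  have split: "(\<Sum>d | d dvd n. \<beta> ^ d) = \<beta> ^ n + (\<Sum>d \<in> {d. d dvd n} - {n}. \<beta> ^ d)"
    using n by (subst sum.remove[of _ n]) auto
  have "(\<Sum>d \<in> {d. d dvd n} - {n}. \<beta> ^ d) \<ge> 0"
    using \<beta> by (intro sum_nonneg) auto
  then show "\<beta> ^ n \<le> (\<Sum>d | d dvd n. \<beta> ^ d)"
    unfolding split by simp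
  have "(\<Sum>d \<in> {d. d dvd n} - {n}. \<beta> ^ d) \<le> (\<Sum>d \<in> {d. d dvd n} - {n}. \<beta> powr (real n / 2))"
  proof (rule sum_mono)
    fix d assume d: "d \<in> {d. d dvd n} - {n}"
    then obtain e where e: "n = d * e" by auto
    have "e \<noteq> 0" "e \<noteq> 1" using d e n by auto
    then have "d * 2 \<le> n" unfolding e by (intro mult_le_mono2) simp
    then have "\<beta> powr real d \<le> \<beta> powr (real n / 2)"
      using \<beta> by (intro powr_mono) auto
    then show "\<beta> ^ d \<le> \<beta> powr (real n / 2)"
      using \<beta> by (simp add: powr_realpow)
  qed
  also have "\<dots> = real (card ({d. d dvd n} - {n})) * \<beta> powr (real n / 2)"
    by simp
  also have "card ({d. d dvd n} - {n}) \<le> card {1..n}"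
    using n by (intro card_mono) (auto simp: Suc_le_eq dvd_pos_nat dvd_imp_le)
  then have "real (card ({d. d dvd n} - {n})) * \<beta> powr (real n / 2) \<le> real n * \<beta> powr (real n / 2)"
    by (intro mult_right_mono) auto
  finally show "(\<Sum>d | d dvd n. \<beta> ^ d) \<le> \<beta> ^ n + real n * \<beta> powr (real n / 2)"
    unfolding split by simp
qed

theorem power_in_RR:
  fixes \<beta> :: real
  assumes \<beta>: "\<beta> > 1"
  shows "(\<lambda>n. nat \<lfloor>\<beta> ^ n\<rfloor>) \<in> RR TYPE('a::infinite)"
proof (rule nat_floor_in_RR)
  show "\<beta> ^ d \<ge> 0" for d using \<beta> by simp
  show "filterlim (\<lambda>n. \<beta> ^ n) at_top sequentially"
    using \<beta> by real_asymp
  show "(\<lambda>n. (\<Sum>d | d dvd n. \<beta> ^ d) / \<beta> ^ n) \<longlonglongrightarrow> 1"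
  proof (rule tendsto_sandwich[OF _ _ tendsto_const])
    show "eventually (\<lambda>n. 1 \<le> (\<Sum>d | d dvd n. \<beta> ^ d) / \<beta> ^ n) sequentially"
      using eventually_gt_at_top[of 0] by eventually_elim
        (use power_divisor_sum_bounds(1)[of \<beta>] \<beta> in \<open>simp add: field_simps\<close>)
    show "eventually (\<lambda>n. (\<Sum>d | d dvd n. \<beta> ^ d) / \<beta> ^ n \<le>
        (\<beta> ^ n + real n * \<beta> powr (real n / 2)) / \<beta> ^ n) sequentially"
      using eventually_gt_at_top[of 0] by eventually_elim
        (use power_divisor_sum_bounds(2)[of \<beta>] \<beta> in \<open>simp add: divide_right_mono\<close>)
    show "(\<lambda>n. (\<beta> ^ n + real n * \<beta> powr (real n / 2)) / \<beta> ^ n) \<longlonglongrightarrow> 1"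
      using \<beta> by real_asymp
  qed
  show "(\<lambda>n. real (\<Sum>d | d dvd n. d) / \<beta> ^ n) \<longlonglongrightarrow> 0"
  proof (rule tendsto_sandwich[OF _ _ tendsto_const])
    show "eventually (\<lambda>n. real (\<Sum>d | d dvd n. d) / \<beta> ^ n \<le> real n ^ 2 / \<beta> ^ n) sequentially"
      using eventually_gt_at_top[of 0]
    proof eventually_elim
      case (elim n)
      have "(\<Sum>d | d dvd n. d) \<le> (\<Sum>d \<in> {1..n}. d)"
        using elim by (intro sum_mono2) (auto simp: Suc_le_eq dvd_pos_nat dvd_imp_le)
      also have "\<dots> \<le> (\<Sum>d \<in> {1..n}. n)"
        by (intro sum_mono) simp
      also have "\<dots> = n ^ 2"
        by (simp add: power2_eq_square)
      finally have "real (\<Sum>d | d dvd n. d) \<le> real (n ^ 2)"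
        by (simp only: of_nat_le_iff)
      then show ?case
        using \<beta> by (intro divide_right_mono) simp_all
    qed
    show "(\<lambda>n. real n ^ 2 / \<beta> ^ n) \<longlonglongrightarrow> 0"
      using \<beta> by real_asymp
  qed (use \<beta> in \<open>simp add: sum_nonneg\<close>)
qed

lemma const_one_in_RR: "(\<lambda>n. 1) \<in> RR TYPE('a::infinite)"
  unfolding RR_iff_orbit_counts
proof
  have "(\<Sum>d | d dvd n. d * of_bool (d = 1)) = 1" if "n > 0" for n :: nat
    using that by (subst sum.remove[of _ 1]) (auto intro!: sum.neutral)
  then show "(\<lambda>n. real (\<Sum>d | d dvd n. d * of_bool (d = 1)) / real 1) \<longlonglongrightarrow> 1"
    by (intro tendsto_eventually eventually_sequentiallyI[of 1]) (simp del: of_nat_sum)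
qed

text \<open>
  Since \<open>x / 0 = 0\<close>, all but finitely many of the quotients vanish.
\<close>

lemma eventually_zero_not_in_RR:
  assumes "eventually (\<lambda>n. \<phi> n = 0) sequentially"
  shows "\<phi> \<notin> RR TYPE('a::infinite)"
proof
  assume "\<phi> \<in> RR TYPE('a)"
  then obtain c :: "nat \<Rightarrow> nat"
    where "(\<lambda>n. real (\<Sum>d | d dvd n. d * c d) / real (\<phi> n)) \<longlonglongrightarrow> 1"
    unfolding RR_iff_orbit_counts by blast
  moreover have "(\<lambda>n. real (\<Sum>d | d dvd n. d * c d) / real (\<phi> n)) \<longlonglongrightarrow> 0"
    by (rule tendsto_eventually) (use assms in eventually_elim, simp)
  ultimately show False
    using LIMSEQ_unique zero_neq_one by metis
qed

section \<open>The three growth regimes\<close>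

theorem theorem3p1:
  fixes \<alpha> \<beta> :: real
  assumes "\<alpha> > 0" and "\<beta> > 0"
  shows "(\<forall>\<phi> :: nat \<Rightarrow> nat. (\<forall>n\<ge>1. \<phi> n > 0) \<longrightarrow> filterlim \<phi> at_top sequentially \<longrightarrow>
            (\<lambda>n. real (\<phi> n) / real n) \<longlonglongrightarrow> 0 \<longrightarrow> \<phi> \<notin> RR TYPE('a::infinite)) \<and>
         ((\<lambda>n. nat \<lfloor>real n powr \<alpha>\<rfloor>) \<in> RR TYPE('a) \<longleftrightarrow> \<alpha> > 1) \<and>
         ((\<lambda>n. nat \<lfloor>\<beta> ^ n\<rfloor>) \<in> RR TYPE('a) \<longleftrightarrow> \<beta> \<ge> 1)"
proof (intro conjI)
  show "\<forall>\<phi> :: nat \<Rightarrow> nat. (\<forall>n\<ge>1. \<phi> n > 0) \<longrightarrow> filterlim \<phi> at_top sequentially \<longrightarrow>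
      (\<lambda>n. real (\<phi> n) / real n) \<longlonglongrightarrow> 0 \<longrightarrow> \<phi> \<notin> RR TYPE('a)"
    using sublinear_not_in_RR by blast
  show "(\<lambda>n. nat \<lfloor>real n powr \<alpha>\<rfloor>) \<in> RR TYPE('a) \<longleftrightarrow> \<alpha> > 1"
  proof
    assume RR: "(\<lambda>n. nat \<lfloor>real n powr \<alpha>\<rfloor>) \<in> RR TYPE('a)"
    show "\<alpha> > 1"
    proof (rule ccontr)
      assume "\<not> \<alpha> > 1"
      then consider "\<alpha> = 1" | "\<alpha> < 1" by linarith
      then show False
      proof cases
        case 1
        then show False using RR linear_not_in_RR[where 'a = 'a] by simp
      next
        case 2
        have "filterlim (\<lambda>n. real n powr \<alpha>) at_top sequentially"
          using \<open>\<alpha> > 0\<close> by real_asymp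
        then have top: "filterlim (\<lambda>n. nat \<lfloor>real n powr \<alpha>\<rfloor>) at_top sequentially"
          by (intro filterlim_compose[OF filterlim_nat_sequentially]
              filterlim_compose[OF filterlim_floor_sequentially])
        have "(\<lambda>n. real (nat \<lfloor>real n powr \<alpha>\<rfloor>) / real n) \<longlonglongrightarrow> 0"
        proof (rule tendsto_sandwich[OF _ _ tendsto_const])
          show "eventually (\<lambda>n. real (nat \<lfloor>real n powr \<alpha>\<rfloor>) / real n \<le> real n powr \<alpha> / real n) sequentially"
            by (intro always_eventually allI divide_right_mono) simp_all
          show "(\<lambda>n. real n powr \<alpha> / real n) \<longlonglongrightarrow> 0"
            using \<open>\<alpha> < 1\<close> by real_asymp
        qed simp
        with top show False
          using RR sublinear_not_in_RR by blast
      qed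
    qed
  qed (rule powr_in_RR)
  show "(\<lambda>n. nat \<lfloor>\<beta> ^ n\<rfloor>) \<in> RR TYPE('a) \<longleftrightarrow> \<beta> \<ge> 1"
  proof
    assume RR: "(\<lambda>n. nat \<lfloor>\<beta> ^ n\<rfloor>) \<in> RR TYPE('a)"
    show "\<beta> \<ge> 1"
    proof (rule ccontr)
      assume "\<not> \<beta> \<ge> 1"
      then have "\<lfloor>\<beta> ^ n\<rfloor> = 0" if "n \<ge> 1" for n
        using \<open>\<beta> > 0\<close> that by (simp add: floor_eq_iff power_less_one_iff)
      then have "eventually (\<lambda>n. nat \<lfloor>\<beta> ^ n\<rfloor> = 0) sequentially"
        by (intro eventually_sequentiallyI[of 1]) simp
      then have "(\<lambda>n. nat \<lfloor>\<beta> ^ n\<rfloor>) \<notin> RR TYPE('a)"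
        by (rule eventually_zero_not_in_RR)
      with RR show False by contradiction
    qed
  next
    assume "\<beta> \<ge> 1"
    then consider "\<beta> = 1" | "\<beta> > 1" by linarith
    then show "(\<lambda>n. nat \<lfloor>\<beta> ^ n\<rfloor>) \<in> RR TYPE('a)"
    proof cases
      case 1
      then show ?thesis using const_one_in_RR by simp
    qed (rule power_in_RR)
  qed
qed

end
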